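(* Let $S=(S_t)_{t\ge0}$ be a zero-drift subordinator with Laplace exponent $\phi$ such that $H(\lambda)=\phi(\lambda)-\lambda\phi'(\lambda)$ satisfies (L) with constants $\gamma,\lambda_L,C_L$ and (U) with constants $\delta,\lambda_U,C_U$ where $\delta<2$. Then there exist constants $M\in(0,1)$, $L>1$ and $c_S>0$ such that for all $t>0$ and $0<r<L^{-1}\lambda_L^{-1}\wedge M\lambda_U^{-1}$ satisfying $t\phi(r^{-1})\le1$, $$\mathbb{P}(r\le S_t\le Lr)\ge c_S\,tH(r^{-1}).$$
   Context: A subordinator $S=(S_t)_{t\ge0}$ is an increasing Lévy process with values in $[0,\infty)$, started at $0$. Its Laplace exponent $\phi$ is defined by $\mathbb{E}e^{-\lambda S_t}=e^{-t\phi(\lambda)}$, $\lambda>0$, and $\phi(\lambda)=b\lambda+\int_{(0,\infty)}(1-e^{-\lambda s})\mu(ds)$, where $b\ge0$ is the drift and $\mu$ is the Lévy measure, a measure on $(0,\infty)$ with $\int_{(0,\infty)}(1\wedge s)\mu(ds)<\infty$. Scaling conditions for $f:(0,\infty)\to(0,\infty)$. (L): there exist $\gamma>0$, $\lambda_L\ge0$, $C_L>0$ such that $f(\lambda x)/f(\lambda)\ge C_Lx^\gamma$ for all $\lambda>\lambda_L$, $x\ge1$. (U): there exist $\delta>0$, $\lambda_U\ge0$, $C_U>0$ such that $f(\lambda x)/f(\lambda)\le C_Ux^\delta$ for all $\lambda>\lambda_U$, $x\ge1$. $a\wedge b=\min\{a,b\}$. Convention: $0^{-1}=+\infty$. *)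

theory Defs
  imports "HOL-Probability.Probability"
begin

definition cadlag :: "(real \<Rightarrow> real) \<Rightarrow> bool" where
  "cadlag f \<longleftrightarrow>
     (\<forall>t\<ge>0. (f \<longlongrightarrow> f t) (at_right t)) \<and>
     (\<forall>t>0. \<exists>l. (f \<longlongrightarrow> l) (at_left t))"

text \<open>
  Processes are indexed by the reals, but only their values at times \<open>t \<ge> 0\<close> matter.
  Path properties are required almost surely.
\<close>

locale levy_process = prob_space P for P :: "'a measure" +
  fixes S :: "real \<Rightarrow> 'a \<Rightarrow> real"
  assumes random_variable_S: "t \<ge> 0 \<Longrightarrow> random_variable borel (S t)"
    and start_zero: "AE \<omega> in P. S 0 \<omega> = 0"
    and independent_increments:
      "0 \<le> u 0 \<Longrightarrow> mono_on {..n} u \<Longrightarrow>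
         indep_vars (\<lambda>_. borel) (\<lambda>i \<omega>. S (u (Suc i)) \<omega> - S (u i) \<omega>) {..<n}"
    and stationary_increments:
      "0 \<le> s \<Longrightarrow> 0 \<le> t \<Longrightarrow>
         distr P borel (\<lambda>\<omega>. S (s + t) \<omega> - S s \<omega>) = distr P borel (S t)"
    and cadlag_paths: "AE \<omega> in P. cadlag (\<lambda>t. S t \<omega>)"

locale subordinator = levy_process +
  assumes nonneg_paths: "AE \<omega> in P. \<forall>t\<ge>0. 0 \<le> S t \<omega>"
    and increasing_paths: "AE \<omega> in P. mono_on {0..} (\<lambda>t. S t \<omega>)"

definition laplace_exponent :: "'a measure \<Rightarrow> (real \<Rightarrow> 'a \<Rightarrow> real) \<Rightarrow> (real \<Rightarrow> real) \<Rightarrow> bool" where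
  "laplace_exponent P S \<phi> \<longleftrightarrow>
     (\<forall>t\<ge>0. \<forall>l>0. (\<integral>\<omega>. exp (- l * S t \<omega>) \<partial>P) = exp (- t * \<phi> l))"

text \<open>A measure on \<open>(0, \<infinity>)\<close> is one whose underlying space is that half-line.\<close>

definition levy_measure :: "real measure \<Rightarrow> bool" where
  "levy_measure \<mu> \<longleftrightarrow>
     sets \<mu> = sets (restrict_space borel {0<..}) \<and>
     (\<integral>\<^sup>+ s. ennreal (min 1 s) \<partial>\<mu>) < \<infinity>"

definition drift_and_levy_measure :: "(real \<Rightarrow> real) \<Rightarrow> real \<Rightarrow> real measure \<Rightarrow> bool" where
  "drift_and_levy_measure \<phi> b \<mu> \<longleftrightarrow>
     b \<ge> 0 \<and> levy_measure \<mu> \<and>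
     (\<forall>l>0. \<phi> l = b * l + (\<integral>s. (1 - exp (- l * s)) \<partial>\<mu>))"

definition H_of :: "(real \<Rightarrow> real) \<Rightarrow> real \<Rightarrow> real" where
  "H_of \<phi> l = \<phi> l - l * deriv \<phi> l"

definition lower_scaling :: "(real \<Rightarrow> real) \<Rightarrow> real \<Rightarrow> real \<Rightarrow> real \<Rightarrow> bool" where
  "lower_scaling f \<gamma> lam C \<longleftrightarrow>
     (\<forall>l>0. f l > 0) \<and> \<gamma> > 0 \<and> lam \<ge> 0 \<and> C > 0 \<and>
     (\<forall>l>lam. \<forall>x\<ge>1. f (l * x) / f l \<ge> C * x powr \<gamma>)"

definition upper_scaling :: "(real \<Rightarrow> real) \<Rightarrow> real \<Rightarrow> real \<Rightarrow> real \<Rightarrow> bool" where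
  "upper_scaling f \<delta> lam C \<longleftrightarrow>
     (\<forall>l>0. f l > 0) \<and> \<delta> > 0 \<and> lam \<ge> 0 \<and> C > 0 \<and>
     (\<forall>l>lam. \<forall>x\<ge>1. f (l * x) / f l \<le> C * x powr \<delta>)"

end

theory Submission
  imports Defs
begin

text \<open>
  Put \<open>k x = 1 - (1 + x) e\<^sup>-\<^sup>x\<close>, which is comparable to \<open>min 1 x\<^sup>2\<close>. Differentiating the Laplace
  transform gives \<open>n E k(\<lambda> S\<^bsub>t/n\<^esub>) \<longrightarrow> t H(\<lambda>)\<close>, so the Levy measure never enters: \<open>n P(S\<^bsub>t/n\<^esub> \<in> \<cdot>)\<close>
  takes its place. At the scale \<open>R = 2 K r\<close> with \<open>K\<close> large, (U) with \<open>\<delta> < 2\<close> makes the contribution of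
  values below \<open>2 r\<close> to \<open>H(1/R)\<close> negligible, and (L) does the same for values above \<open>\<rho> = Q R\<close> with \<open>Q\<close>
  large. Hence \<open>n P(2 r < S\<^bsub>t/n\<^esub> \<le> \<rho>)\<close> is asymptotically at least \<open>t H(1/R) / 2\<close>. Finally \<open>S\<^sub>t\<close> lies in
  \<open>[2 r, \<rho> + 2 r]\<close> if one of \<open>n\<close> increments lies in \<open>(2 r, \<rho>]\<close> and the others add up to at most \<open>2 r\<close>;
  the latter has probability at least \<open>P(S\<^sub>t \<le> 2 r) \<ge> e\<^sup>-\<^sup>1 - e\<^sup>-\<^sup>2\<close>, because \<open>t \<phi>(1/r) \<le> 1\<close>.
\<close>

section \<open>Elementary bounds for the kernel\<close>

text \<open>The operation f(l) - l f'(l), which turns \<phi> into \<open>H_of \<phi>\<close>, turns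
  1 - exp (- l x) into \<open>lap_kernel (l * x)\<close>.\<close>

definition lap_kernel :: "real \<Rightarrow> real" where
  "lap_kernel x = 1 - (1 + x) * exp (- x)"

lemma lap_kernel_le_square: "0 \<le> x \<Longrightarrow> lap_kernel x \<le> x\<^sup>2"
proof -
  assume "0 \<le> x"
  then have "(1 + x) * (1 - x) \<le> (1 + x) * exp (- x)"
    using exp_ge_add_one_self[of "- x"] by (intro mult_left_mono) auto
  then show ?thesis
    by (simp add: lap_kernel_def algebra_simps power2_eq_square)
qed

lemma lap_kernel_ge: "0 \<le> x \<Longrightarrow> exp (- x) * x\<^sup>2 / 2 \<le> lap_kernel x"
proof -
  assume "0 \<le> x"
  then have "exp (- x) * (1 + x + x\<^sup>2 / 2) \<le> exp (- x) * exp x"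
    by (intro mult_left_mono exp_lower_Taylor_quadratic) auto
  also have "\<dots> = 1" by (simp flip: exp_add)
  finally show ?thesis
    by (simp add: lap_kernel_def algebra_simps)
qed

lemma lap_kernel_nonneg: "0 \<le> x \<Longrightarrow> 0 \<le> lap_kernel x"
  by (rule order_trans[OF _ lap_kernel_ge]) auto

lemma lap_kernel_le_1: "0 \<le> x \<Longrightarrow> lap_kernel x \<le> 1"
  by (simp add: lap_kernel_def)

text \<open>The factor 6 is 3 times 2: \<open>exp x \<le> 3\<close> on the unit interval, and the
  1/2 in \<open>lap_kernel_ge\<close>.\<close>

lemma lap_kernel_ge_square:
  assumes "0 \<le> x" "x \<le> 1"
  shows "x\<^sup>2 \<le> 6 * lap_kernel x"
proof -
  have "exp x \<le> 3"
    using assms exp_le by (smt (verit) exp_le_cancel_iff)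
  then have "1 \<le> 3 * exp (- x)"
    by (simp add: exp_minus field_simps)
  then have "x\<^sup>2 \<le> 3 * exp (- x) * x\<^sup>2"
    using mult_right_mono[of 1 "3 * exp (- x)" "x\<^sup>2"] by simp
  then show ?thesis
    using lap_kernel_ge[OF assms(1)] by simp
qed

text \<open>The claim amounts to 5 (1 + x) \<le> 4 exp x, which the quadratic Taylor bound yields
  because 1 + x \<le> 2 x^2 for x \<ge> 1.\<close>

lemma lap_kernel_ge_fifth:
  assumes "1 \<le> x"
  shows "1 \<le> 5 * lap_kernel x"
proof -
  have "1 + x \<le> 4 * (x\<^sup>2 / 2)"
  proof -
    have "1 * x \<le> x * x" using assms by (intro mult_right_mono) auto
    then show ?thesis using assms unfolding power2_eq_square by linarith
  qed
  then have "5 * (1 + x) \<le> 4 * (1 + x + x\<^sup>2 / 2)" by simp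
  also have "\<dots> \<le> 4 * exp x"
    using assms exp_lower_Taylor_quadratic[of x] by simp
  finally show ?thesis
    by (simp add: lap_kernel_def exp_minus field_simps)
qed

lemma lap_kernel_measurable [measurable]: "lap_kernel \<in> borel_measurable borel"
  unfolding lap_kernel_def by measurable

text \<open>Up to \<open>a\<close>, the quadratic upper bound at scale \<open>R\<close> meets the
  quadratic lower bound at scale \<open>a\<close>, whence the factor (a / R)^2. Beyond \<rho> the
  kernel at scale \<rho> is at least 1/5. In between the trivial bound 1 is kept; it becomes a
  probability once \<open>x\<close> is a random increment.\<close>

lemma lap_kernel_scale_split:
  assumes "0 \<le> x" "0 < a" "0 < R" "0 < \<rho>" "R \<le> \<rho>"
  shows "lap_kernel (x / R)
    \<le> 6 * (a / R)\<^sup>2 * lap_kernel (x / a) + indicator {a<..\<rho>} x + 5 * lap_kernel (x / \<rho>)"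
proof -
  have nn: "0 \<le> 6 * (a / R)\<^sup>2 * lap_kernel (x / a)" "0 \<le> lap_kernel (x / \<rho>)"
    using assms by (auto intro!: lap_kernel_nonneg mult_nonneg_nonneg)
  consider "x \<le> a" | "a < x" "x \<le> \<rho>" | "\<rho> < x" by linarith
  then show ?thesis
  proof cases
    case 1
    have "lap_kernel (x / R) \<le> (x / R)\<^sup>2"
      using assms by (intro lap_kernel_le_square) auto
    also have "\<dots> = (a / R)\<^sup>2 * (x / a)\<^sup>2"
      using assms by (simp add: power_divide)
    also have "\<dots> \<le> (a / R)\<^sup>2 * (6 * lap_kernel (x / a))"
      using assms 1 by (intro mult_left_mono lap_kernel_ge_square) auto
    finally show ?thesis using 1 nn by (simp add: indicator_def)
  next
    case 2
    then have "indicator {a<..\<rho>} x = (1::real)" by simp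
    moreover have "lap_kernel (x / R) \<le> 1"
      using assms by (intro lap_kernel_le_1) auto
    ultimately show ?thesis using nn by linarith
  next
    case 3
    then have "1 \<le> 5 * lap_kernel (x / \<rho>)"
      using assms by (intro lap_kernel_ge_fifth) auto
    moreover have "lap_kernel (x / R) \<le> 1"
      using assms by (intro lap_kernel_le_1) auto
    moreover have "indicator {a<..\<rho>} x = (0::real)" using 3 by simp
    ultimately show ?thesis using nn by linarith
  qed
qed

section \<open>Differentiation of Laplace transforms\<close>

text \<open>Supplies the dominating constant for differentiating under the expectation without any
  moment assumption. Since 1 - exp (- z) \<le> z, the quotient is at most x exp (- c x), and z exp
  (- z) \<le> 1 turns this into 1 / c.\<close>

lemma exp_difference_quotient_bound:
  fixes x y l c :: real
  assumes "0 \<le> x" "0 < c" "c \<le> y" "c \<le> l" "y \<noteq> l"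
  shows "\<bar>(exp (- y * x) - exp (- l * x)) / (y - l)\<bar> \<le> 1 / c"
proof -
  have *: "exp (- u * x) - exp (- v * x) \<le> (v - u) / c" if "c \<le> u" "u < v" for u v
  proof -
    have "exp (- u * x) - exp (- v * x) = exp (- u * x) * (1 - exp (- ((v - u) * x)))"
      by (simp add: algebra_simps flip: exp_add)
    also have "\<dots> \<le> exp (- u * x) * ((v - u) * x)"
      using exp_ge_add_one_self[of "- ((v - u) * x)"] by (intro mult_left_mono) auto
    also have "\<dots> \<le> exp (- c * x) * ((v - u) * x)"
      using that assms by (intro mult_right_mono) (auto intro!: mult_right_mono)
    also have "\<dots> = (v - u) / c * ((c * x) * exp (- (c * x)))"
      using assms by simp
    also have "\<dots> \<le> (v - u) / c * 1"
    proof (rule mult_left_mono)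
      have "c * x \<le> exp (c * x)" using exp_ge_add_one_self[of "c * x"] by linarith
      then have "c * x * exp (- (c * x)) \<le> exp (c * x) * exp (- (c * x))"
        by (rule mult_right_mono) simp
      then show "c * x * exp (- (c * x)) \<le> 1" by (simp flip: exp_add)
      show "0 \<le> (v - u) / c" using that assms by simp
    qed
    finally show ?thesis by simp
  qed
  have mono: "exp (- v * x) \<le> exp (- u * x)" if "u \<le> v" for u v
    using that assms by (auto intro: mult_right_mono)
  show ?thesis
  proof (cases "y < l")
    case True
    then show ?thesis using *[of y l] mono[of y l] assms
      by (simp add: abs_if field_simps split: if_splits)
  next
    case False
    then show ?thesis using *[of l y] mono[of l y] assms
      by (simp add: abs_if field_simps split: if_splits)
  qed
qed

lemma (in prob_space) laplace_transform_has_derivative: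
  fixes X :: "'a \<Rightarrow> real"
  assumes [measurable]: "random_variable borel X"
    and nn: "AE \<omega> in M. 0 \<le> X \<omega>" and l: "0 < l"
  shows "((\<lambda>l. \<integral>\<omega>. exp (- l * X \<omega>) \<partial>M) has_real_derivative
           - (\<integral>\<omega>. X \<omega> * exp (- l * X \<omega>) \<partial>M)) (at l)"
proof -
  let ?F = "\<lambda>l. \<integral>\<omega>. exp (- l * X \<omega>) \<partial>M"
  have int: "integrable M (\<lambda>\<omega>. exp (- y * X \<omega>))" if "0 < y" for y
    by (rule integrable_const_bound[where B = 1]) (use nn that in auto)
  \<comment> \<open>Staying above l/2 bounds all difference quotients by 2/l. As this half-line is
    open and contains \<open>l\<close>, the limit within it is the full derivative.\<close>
  have "((\<lambda>y. (?F y - ?F l) / (y - l)) \<longlongrightarrow> - (\<integral>\<omega>. X \<omega> * exp (- l * X \<omega>) \<partial>M))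
         (at l within {l/2<..})"
    unfolding tendsto_at_iff_sequentially
  proof (intro allI impI)
    fix y assume y: "\<forall>i. y i \<in> {l/2<..} - {l}" and lim: "y \<longlonglongrightarrow> l"
    have yp: "0 < y i" "l/2 \<le> y i" "y i \<noteq> l" for i
      using y[rule_format, of i] l by auto
    have "(\<lambda>i. \<integral>\<omega>. (exp (- y i * X \<omega>) - exp (- l * X \<omega>)) / (y i - l) \<partial>M)
            \<longlonglongrightarrow> (\<integral>\<omega>. - (X \<omega> * exp (- l * X \<omega>)) \<partial>M)"
    proof (rule integral_dominated_convergence[where w = "\<lambda>_. 1 / (l/2)"])
      show "AE \<omega> in M. (\<lambda>i. (exp (- y i * X \<omega>) - exp (- l * X \<omega>)) / (y i - l))
              \<longlonglongrightarrow> - (X \<omega> * exp (- l * X \<omega>))"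
      proof (rule AE_I2)
        fix \<omega>
        have "((\<lambda>y. exp (- y * X \<omega>)) has_real_derivative - (X \<omega> * exp (- l * X \<omega>))) (at l)"
          by (auto intro!: derivative_eq_intros)
        then have "((\<lambda>y. (exp (- y * X \<omega>) - exp (- l * X \<omega>)) / (y - l))
            \<longlongrightarrow> - (X \<omega> * exp (- l * X \<omega>))) (at l)"
          by (simp add: has_field_derivative_iff)
        then show "(\<lambda>i. (exp (- y i * X \<omega>) - exp (- l * X \<omega>)) / (y i - l))
              \<longlonglongrightarrow> - (X \<omega> * exp (- l * X \<omega>))"
          using yp lim unfolding tendsto_at_iff_sequentially comp_def by auto
      qed
      show "AE \<omega> in M. norm ((exp (- y i * X \<omega>) - exp (- l * X \<omega>)) / (y i - l)) \<le> 1 / (l/2)" for i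
        using nn
      proof eventually_elim
        case (elim \<omega>)
        show ?case
          using exp_difference_quotient_bound[of "X \<omega>" "l/2" "y i" l] elim yp[of i] l by simp
      qed
    qed auto
    moreover have "(\<integral>\<omega>. (exp (- y i * X \<omega>) - exp (- l * X \<omega>)) / (y i - l) \<partial>M)
        = (?F (y i) - ?F l) / (y i - l)" for i
      by (simp only: integral_divide_zero Bochner_Integration.integral_diff[OF int[OF yp(1)] int[OF l]])
    ultimately show "((\<lambda>y. (?F y - ?F l) / (y - l)) \<circ> y)
        \<longlonglongrightarrow> - (\<integral>\<omega>. X \<omega> * exp (- l * X \<omega>) \<partial>M)"
      by (simp only: comp_def integral_minus)
  qed
  then show ?thesis
    using l by (simp add: has_field_derivative_iff at_within_open[of _ "{l/2<..}"])
qed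

section \<open>Small-time asymptotics of the kernel's expectation\<close>

context subordinator
begin

lemma AE_nonneg: "0 \<le> t \<Longrightarrow> AE \<omega> in P. 0 \<le> S t \<omega>"
  using nonneg_paths by (rule AE_mp) auto

lemma integrable_lap_kernel:
  assumes "0 \<le> s" "0 < l"
  shows "integrable P (\<lambda>\<omega>. lap_kernel (l * S s \<omega>))"
proof (rule integrable_const_bound[where B = 1])
  note [measurable] = random_variable_S[OF assms(1)]
  show "(\<lambda>\<omega>. lap_kernel (l * S s \<omega>)) \<in> borel_measurable P" by measurable
  show "AE \<omega> in P. norm (lap_kernel (l * S s \<omega>)) \<le> 1"
    using AE_nonneg[OF assms(1)]
    by eventually_elim (use assms lap_kernel_nonneg lap_kernel_le_1 in auto)
qed

text \<open>\<phi> is minus the logarithm of the Laplace transform of \<open>S 1\<close>, which is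
  positive and differentiable. Hence \<open>deriv \<phi> l\<close> in \<open>H_of\<close> is a true
  derivative and not an arbitrary value.\<close>

lemma laplace_exponent_has_derivative:
  assumes \<phi>: "laplace_exponent P S \<phi>" and l: "0 < l"
  shows "(\<phi> has_real_derivative deriv \<phi> l) (at l)"
proof -
  let ?F = "\<lambda>l. \<integral>\<omega>. exp (- l * S 1 \<omega>) \<partial>P"
  have F: "?F y = exp (- \<phi> y)" if "0 < y" for y
    using \<phi> that by (auto simp: laplace_exponent_def dest: spec[of _ 1])
  have "0 < ?F l" using F[OF l] by simp
  moreover have "(?F has_real_derivative - (\<integral>\<omega>. S 1 \<omega> * exp (- l * S 1 \<omega>) \<partial>P)) (at l)"
    by (intro laplace_transform_has_derivative random_variable_S AE_nonneg l) auto
  ultimately have "((\<lambda>y. - ln (?F y)) has_real_derivative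
          - (1 / ?F l * - (\<integral>\<omega>. S 1 \<omega> * exp (- l * S 1 \<omega>) \<partial>P))) (at l)"
    by (intro DERIV_minus DERIV_chain2[OF DERIV_ln_divide])
  then have "(\<phi> has_real_derivative
          - (1 / ?F l * - (\<integral>\<omega>. S 1 \<omega> * exp (- l * S 1 \<omega>) \<partial>P))) (at l)"
    by (rule has_field_derivative_transform_within_open[of _ _ _ "{0<..}"]) (use F l in auto)
  then show ?thesis
    by (auto simp: DERIV_deriv_iff_real_differentiable real_differentiable_def)
qed

text \<open>With F the Laplace transform of \<open>S s\<close>, the expectation is 1 - F(l) + l
  F'(l). Computing F' both from exp (- s \<phi>) and under the expectation identifies the last
  term.\<close>

lemma expectation_lap_kernel:
  assumes \<phi>: "laplace_exponent P S \<phi>" and s: "0 \<le> s" and l: "0 < l"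
  shows "expectation (\<lambda>\<omega>. lap_kernel (l * S s \<omega>))
           = 1 - exp (- s * \<phi> l) - l * s * deriv \<phi> l * exp (- s * \<phi> l)"
proof -
  note [measurable] = random_variable_S[OF s]
  let ?F = "\<lambda>l. \<integral>\<omega>. exp (- l * S s \<omega>) \<partial>P"
  have F: "?F y = exp (- s * \<phi> y)" if "0 < y" for y
    using \<phi> s that by (auto simp: laplace_exponent_def)
  have "((\<lambda>y. exp (- s * \<phi> y)) has_real_derivative - s * deriv \<phi> l * exp (- s * \<phi> l)) (at l)"
    by (rule derivative_eq_intros laplace_exponent_has_derivative[OF \<phi> l] refl | simp)+
  then have "(?F has_real_derivative - s * deriv \<phi> l * exp (- s * \<phi> l)) (at l)"
    by (rule has_field_derivative_transform_within_open[of _ _ _ "{0<..}"]) (use F l in auto)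
  moreover have "(?F has_real_derivative - (\<integral>\<omega>. S s \<omega> * exp (- l * S s \<omega>) \<partial>P)) (at l)"
    by (intro laplace_transform_has_derivative AE_nonneg s l) measurable
  ultimately have G: "(\<integral>\<omega>. S s \<omega> * exp (- l * S s \<omega>) \<partial>P) = s * deriv \<phi> l * exp (- s * \<phi> l)"
    by (auto dest: DERIV_unique)
  have int1: "integrable P (\<lambda>\<omega>. exp (- l * S s \<omega>))"
    by (rule integrable_const_bound[where B = 1]) (use AE_nonneg[OF s] l in auto)
  have int2: "integrable P (\<lambda>\<omega>. S s \<omega> * exp (- l * S s \<omega>))"
  proof -
    \<comment> \<open>The definition of the kernel is solved for the product x exp (- l x), so that
      integrability follows from that of bounded terms.\<close>
    have "integrable P (\<lambda>\<omega>. (1 - exp (- l * S s \<omega>) - lap_kernel (l * S s \<omega>)) / l)"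
      using int1 integrable_lap_kernel[OF s l] by simp
    then show ?thesis
      using l by (simp add: lap_kernel_def algebra_simps)
  qed
  have "expectation (\<lambda>\<omega>. lap_kernel (l * S s \<omega>))
      = expectation (\<lambda>\<omega>. 1 - exp (- l * S s \<omega>) - l * (S s \<omega> * exp (- l * S s \<omega>)))"
    by (simp add: lap_kernel_def algebra_simps)
  also have "\<dots> = 1 - ?F l - l * (\<integral>\<omega>. S s \<omega> * exp (- l * S s \<omega>) \<partial>P)"
    using int1 int2 by (simp add: prob_space)
  finally show ?thesis using F[OF l] G by simp
qed

text \<open>In the closed form of the expectation at time t/n, n (1 - exp (- t \<phi>(l) / n)) tends
  to t \<phi>(l) as a derivative of the exponential at 0, while the exponential next to
  \<open>deriv \<phi> l\<close> tends to 1.\<close>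

lemma lap_kernel_limit:
  assumes \<phi>: "laplace_exponent P S \<phi>" and t: "0 < t" and l: "0 < l"
  shows "(\<lambda>n. real n * expectation (\<lambda>\<omega>. lap_kernel (l * S (t / real n) \<omega>))) \<longlonglongrightarrow> t * H_of \<phi> l"
proof -
  let ?p = "t * \<phi> l" and ?h = "\<lambda>n::nat. 1 / real n"
  have h: "filterlim ?h (at 0) sequentially"
    unfolding filterlim_at
    by (auto intro: lim_1_over_n eventually_sequentiallyI[of 1])
  have "((\<lambda>x. exp (- x * ?p)) has_real_derivative - ?p) (at 0)"
    by (auto intro!: derivative_eq_intros)
  then have "((\<lambda>x. (exp (- x * ?p) - 1) / x) \<longlongrightarrow> - ?p) (at 0)"
    by (simp add: has_field_derivative_iff)
  from filterlim_compose[OF this h]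
  have 1: "(\<lambda>n. real n * (exp (- ?h n * ?p) - 1)) \<longlonglongrightarrow> - ?p"
    by (simp add: mult.commute)
  have "(\<lambda>n. exp (- ?h n * ?p)) \<longlonglongrightarrow> exp (- 0 * ?p)"
    by (intro tendsto_intros lim_1_over_n)
  then have 2: "(\<lambda>n. exp (- ?h n * ?p)) \<longlonglongrightarrow> 1" by simp
  have "(\<lambda>n. - (real n * (exp (- ?h n * ?p) - 1)) - l * t * deriv \<phi> l * exp (- ?h n * ?p))
      \<longlonglongrightarrow> - (- ?p) - l * t * deriv \<phi> l * 1"
    by (intro tendsto_intros 1 2)
  moreover have "- (- ?p) - l * t * deriv \<phi> l * 1 = t * H_of \<phi> l"
    by (simp add: H_of_def algebra_simps)
  moreover have "eventually (\<lambda>n. - (real n * (exp (- ?h n * ?p) - 1)) - l * t * deriv \<phi> l * exp (- ?h n * ?p)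
      = real n * expectation (\<lambda>\<omega>. lap_kernel (l * S (t / real n) \<omega>))) sequentially"
    using eventually_gt_at_top[of 0]
  proof eventually_elim
    case (elim n)
    then show ?case
      using t by (simp add: expectation_lap_kernel[OF \<phi> _ l] field_simps)
  qed
  ultimately show ?thesis
    by (auto intro: Lim_transform_eventually)
qed

section \<open>Lower bounds for probabilities of \<open>S t\<close>\<close>

text \<open>A Chernoff-type argument: exp (- S t / r) is at most 1 on the event and at most exp (-
  2) off it, while its expectation exp (- t \<phi>(1/r)) is at least exp (- 1).\<close>

lemma prob_le_ge:
  assumes \<phi>: "laplace_exponent P S \<phi>" and t: "0 \<le> t" and r: "0 < r" and le: "t * \<phi> (inverse r) \<le> 1"
  shows "exp (- 1) - exp (- 2) \<le> prob {\<omega>\<in>space P. S t \<omega> \<le> 2 * r}"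
proof -
  note [measurable] = random_variable_S[OF t]
  let ?A = "{\<omega>\<in>space P. S t \<omega> \<le> 2 * r}"
  have "exp (- 1) \<le> exp (- t * \<phi> (inverse r))" using le by simp
  also have "\<dots> = expectation (\<lambda>\<omega>. exp (- inverse r * S t \<omega>))"
    using \<phi> t r by (simp add: laplace_exponent_def)
  also have "\<dots> \<le> expectation (\<lambda>\<omega>. indicator ?A \<omega> + exp (- 2))"
  proof (rule integral_mono_AE)
    show "integrable P (\<lambda>\<omega>. exp (- inverse r * S t \<omega>))"
      by (rule integrable_const_bound[where B = 1]) (use AE_nonneg[OF t] r in auto)
    show "integrable P (\<lambda>\<omega>. indicator ?A \<omega> + exp (- 2) :: real)"
      by (auto intro!: integrable_real_indicator simp: emeasure_eq_measure)
    show "AE \<omega> in P. exp (- inverse r * S t \<omega>) \<le> indicator ?A \<omega> + exp (- 2)"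
      using AE_nonneg[OF t] AE_space
    proof eventually_elim
      case (elim \<omega>)
      show ?case
      proof (cases "\<omega> \<in> ?A")
        case True
        have "exp (- inverse r * S t \<omega>) \<le> 1" using elim r by simp
        then show ?thesis using True by (simp add: add_increasing2)
      next
        case False
        then have "2 \<le> inverse r * S t \<omega>" using elim r by (simp add: field_simps)
        then show ?thesis using False by simp
      qed
    qed
  qed
  also have "\<dots> = prob ?A + exp (- 2)"
    by (subst Bochner_Integration.integral_add) (auto simp: prob_space emeasure_eq_measure)
  finally show ?thesis by simp
qed

text \<open>
  Cut \<open>[0, t]\<close> into \<open>n\<close> equal pieces. The events that the \<open>i\<close>-th increment lies in \<open>(a, b]\<close> while
  the other increments add up to at most \<open>a\<close> are pairwise disjoint.
\<close>
lemma single_big_increment: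
  assumes t: "0 < t" and n: "0 < n" and a: "0 < a"
  shows "real n * prob {\<omega>\<in>space P. a < S (t / real n) \<omega> \<and> S (t / real n) \<omega> \<le> b}
           * prob {\<omega>\<in>space P. S t \<omega> \<le> a}
         \<le> prob {\<omega>\<in>space P. a \<le> S t \<omega> \<and> S t \<omega> \<le> b + a}"
proof -
  define u where "u i = t * real i / real n" for i
  define D where "D i \<omega> = S (u (Suc i)) \<omega> - S (u i) \<omega>" for i \<omega>
  define T where "T i \<omega> = (\<Sum>j\<in>{..<n} - {i}. D j \<omega>)" for i \<omega>
  have u: "0 \<le> u i" "u i \<le> u (Suc i)" for i
    using t n by (auto simp: u_def field_simps)
  note [measurable] = random_variable_S[OF u(1)] random_variable_S[OF order.strict_implies_order[OF t]]
  have [measurable]: "random_variable borel (D i)" for i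
    unfolding D_def[abs_def] by measurable
  have [measurable]: "random_variable borel (T i)" for i
    unfolding T_def[abs_def] by measurable
  have tn: "random_variable borel (S (t / real n))"
    using t by (intro random_variable_S) auto
  have indep: "indep_vars (\<lambda>_. borel) D {..<n}"
    unfolding D_def[abs_def]
    by (rule independent_increments) (use t n in \<open>auto simp: u_def mono_on_def field_simps\<close>)
  have D_eq: "prob {\<omega>\<in>space P. D i \<omega> \<in> {a<..b}} = prob {\<omega>\<in>space P. S (t / real n) \<omega> \<in> {a<..b}}" for i
  proof -
    have "distr P borel (D i) = distr P borel (S (t / real n))"
      using stationary_increments[of "u i" "t / real n"] t u(1)
      by (simp add: D_def[abs_def] u_def add_divide_distrib distrib_left add.commute)
    then have "measure (distr P borel (D i)) {a<..b} = measure (distr P borel (S (t / real n))) {a<..b}"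
      by simp
    then show ?thesis
      using tn by (simp add: measure_distr vimage_def Int_def conj_commute)
  qed
  have AE_D: "AE \<omega> in P. \<forall>i. 0 \<le> D i \<omega>"
    using increasing_paths by (rule AE_mp) (use u in \<open>auto simp: D_def mono_on_def\<close>)
  have "(\<Sum>i<n. D i \<omega>) = S t \<omega> - S 0 \<omega>" for \<omega>
  proof -
    have "u n = t" "u 0 = 0" using n by (auto simp: u_def)
    then show ?thesis
      unfolding D_def using sum_lessThan_telescope[of "\<lambda>i. S (u i) \<omega>" n] by (simp only:)
  qed
  then have "AE \<omega> in P. (\<Sum>i<n. D i \<omega>) = S t \<omega>"
    using start_zero by auto
  then have AE_T: "AE \<omega> in P. \<forall>i<n. S t \<omega> = D i \<omega> + T i \<omega>"
    by (rule AE_mp) (auto simp: T_def sum.remove[of "{..<n}" for n])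
  \<comment> \<open>Nonnegativity of the increments holds almost surely anyway; building it into the
    events makes them disjoint as sets.\<close>
  define A where "A i = {\<omega>\<in>space P. D i \<omega> \<in> {a<..b}} \<inter> {\<omega>\<in>space P. T i \<omega> \<le> a}
      \<inter> {\<omega>\<in>space P. \<forall>j<n. 0 \<le> D j \<omega>}" for i
  have A_sets: "A i \<in> events" for i
    unfolding A_def by measurable
  have A_prob: "prob {\<omega>\<in>space P. a < S (t / real n) \<omega> \<and> S (t / real n) \<omega> \<le> b}
           * prob {\<omega>\<in>space P. S t \<omega> \<le> a} \<le> prob (A i)" if i: "i < n" for i
  proof -
    have "indep_var borel (D i) borel (T i)"
      unfolding T_def[abs_def]
      by (rule indep_vars_sum) (use indep i in \<open>auto simp: insert_absorb\<close>)
    then have "prob {\<omega>\<in>space P. D i \<omega> \<in> {a<..b} \<and> T i \<omega> \<in> {..a}}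
        = prob {\<omega>\<in>space P. D i \<omega> \<in> {a<..b}} * prob {\<omega>\<in>space P. T i \<omega> \<in> {..a}}"
      using indep_varD[of borel "D i" borel "T i" "{a<..b}" "{..a}"]
      by (simp add: vimage_def Int_def conj_commute)
    moreover have "prob (A i) = prob {\<omega>\<in>space P. D i \<omega> \<in> {a<..b} \<and> T i \<omega> \<in> {..a}}"
    proof (rule finite_measure_eq_AE)
      show "AE \<omega> in P. \<omega> \<in> A i \<longleftrightarrow> \<omega> \<in> {\<omega>\<in>space P. D i \<omega> \<in> {a<..b} \<and> T i \<omega> \<in> {..a}}"
        using AE_D by eventually_elim (auto simp: A_def)
    qed (use A_sets in simp, measurable)
    moreover have "prob {\<omega>\<in>space P. S t \<omega> \<le> a} \<le> prob {\<omega>\<in>space P. T i \<omega> \<in> {..a}}"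
    proof (rule finite_measure_mono_AE)
      show "AE \<omega> in P. \<omega> \<in> {\<omega>\<in>space P. S t \<omega> \<le> a} \<longrightarrow> \<omega> \<in> {\<omega>\<in>space P. T i \<omega> \<in> {..a}}"
        using AE_D AE_T
      proof eventually_elim
        case (elim \<omega>)
        \<comment> \<open>Leaving out one nonnegative increment can only decrease the sum.\<close>
        then have "T i \<omega> \<le> S t \<omega>" using i by simp
        then show ?case by auto
      qed
    qed measurable
    ultimately show ?thesis
      using D_eq[of i] by (simp add: mult_left_mono)
  qed
  have "disjoint_family_on A {..<n}"
    unfolding disjoint_family_on_def
  proof (intro ballI impI)
    fix i j assume ij: "i \<in> {..<n}" "j \<in> {..<n}" "i \<noteq> j"
    show "A i \<inter> A j = {}"
    proof safe
      fix \<omega> assume "\<omega> \<in> A i" "\<omega> \<in> A j"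
      then have *: "a < D i \<omega>" "T j \<omega> \<le> a" "\<forall>j<n. 0 \<le> D j \<omega>"
        by (auto simp: A_def)
      \<comment> \<open>For i \<noteq> j the increment \<open>D i\<close> is one of the summands of
        \<open>T j\<close>, so it cannot exceed \<open>a\<close> on \<open>A j\<close>.\<close>
      have "D i \<omega> \<le> T j \<omega>"
        unfolding T_def using ij * by (intro member_le_sum) auto
      then show "\<omega> \<in> {}" using * by simp
    qed
  qed
  then have "(\<Sum>i<n. prob (A i)) = prob (\<Union>i<n. A i)"
    using A_sets by (subst finite_measure_finite_Union) auto
  also have "\<dots> \<le> prob {\<omega>\<in>space P. a \<le> S t \<omega> \<and> S t \<omega> \<le> b + a}"
  proof (rule finite_measure_mono_AE)
    show "AE \<omega> in P. \<omega> \<in> (\<Union>i<n. A i) \<longrightarrow> \<omega> \<in> {\<omega>\<in>space P. a \<le> S t \<omega> \<and> S t \<omega> \<le> b + a}"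
      using AE_T
    proof eventually_elim
      case (elim \<omega>)
      have "a \<le> S t \<omega> \<and> S t \<omega> \<le> b + a" if "i < n" "\<omega> \<in> A i" for i
      proof -
        have "0 \<le> T i \<omega>"
          unfolding T_def using that by (intro sum_nonneg) (auto simp: A_def)
        then show ?thesis using elim that by (auto simp: A_def)
      qed
      then show ?case by (auto simp: A_def)
    qed
  qed measurable
  finally have "(\<Sum>i<n. prob (A i)) \<le> prob {\<omega>\<in>space P. a \<le> S t \<omega> \<and> S t \<omega> \<le> b + a}" .
  moreover have "(\<Sum>i<n. prob {\<omega>\<in>space P. a < S (t / real n) \<omega> \<and> S (t / real n) \<omega> \<le> b}
      * prob {\<omega>\<in>space P. S t \<omega> \<le> a}) \<le> (\<Sum>i<n. prob (A i))"
    by (rule sum_mono) (simp add: A_prob)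
  ultimately show ?thesis by (simp add: mult.assoc)
qed

text \<open>The scale splitting with a = 2 r is averaged over \<open>S (t / n)\<close> and
  multiplied by n, and its middle term is bounded by \<open>single_big_increment\<close>. The
  resulting upper bound does not depend on n, so the kernel expectations can be replaced by their
  limits t H.\<close>

lemma prob_interval_ge_H:
  assumes \<phi>: "laplace_exponent P S \<phi>" and t: "0 < t" and r: "0 < r"
    and le: "t * \<phi> (inverse r) \<le> 1" and R: "0 < R" "R \<le> \<rho>"
  shows "(exp (- 1) - exp (- 2)) * (t * H_of \<phi> (1 / R)
            - 6 * (2 * r / R)\<^sup>2 * (t * H_of \<phi> (1 / (2 * r))) - 5 * (t * H_of \<phi> (1 / \<rho>)))
         \<le> prob {\<omega>\<in>space P. 2 * r \<le> S t \<omega> \<and> S t \<omega> \<le> \<rho> + 2 * r}"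
proof -
  have \<rho>: "0 < \<rho>" using R by linarith
  define c where "c = exp (- 1) - exp (- 2 :: real)"
  have c: "0 < c" by (simp add: c_def)
  define E where "E l n = expectation (\<lambda>\<omega>. lap_kernel (l * S (t / real n) \<omega>))" for l and n :: nat
  have lim: "(\<lambda>n. real n * E l n) \<longlonglongrightarrow> t * H_of \<phi> l" if "0 < l" for l
    unfolding E_def by (rule lap_kernel_limit[OF \<phi> t that])
  let ?Q = "prob {\<omega>\<in>space P. 2 * r \<le> S t \<omega> \<and> S t \<omega> \<le> \<rho> + 2 * r}"
  have "(\<lambda>n. c * (real n * E (1 / R) n - 6 * (2 * r / R)\<^sup>2 * (real n * E (1 / (2 * r)) n)
               - 5 * (real n * E (1 / \<rho>) n)))
        \<longlonglongrightarrow> c * (t * H_of \<phi> (1 / R)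
            - 6 * (2 * r / R)\<^sup>2 * (t * H_of \<phi> (1 / (2 * r))) - 5 * (t * H_of \<phi> (1 / \<rho>)))"
    using r R \<rho> by (intro tendsto_intros lim) auto
  moreover have "\<forall>\<^sub>F n in sequentially. c * (real n * E (1 / R) n
      - 6 * (2 * r / R)\<^sup>2 * (real n * E (1 / (2 * r)) n) - 5 * (real n * E (1 / \<rho>) n)) \<le> ?Q"
    using eventually_gt_at_top[of 0]
  proof eventually_elim
    case (elim n)
    have s: "0 \<le> t / real n" using t by simp
    note [measurable] = random_variable_S[OF s]
    let ?B = "{\<omega>\<in>space P. 2 * r < S (t / real n) \<omega> \<and> S (t / real n) \<omega> \<le> \<rho>}"
    note int = integrable_lap_kernel[OF s]
    have intB: "integrable P (indicator ?B :: _ \<Rightarrow> real)"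
      by (auto intro!: integrable_real_indicator simp: emeasure_eq_measure)
    have "E (1 / R) n \<le> expectation (\<lambda>\<omega>. 6 * (2 * r / R)\<^sup>2 * lap_kernel (1 / (2 * r) * S (t / real n) \<omega>)
        + indicator ?B \<omega> + 5 * lap_kernel (1 / \<rho> * S (t / real n) \<omega>))"
      unfolding E_def
    proof (rule integral_mono_AE)
      show "integrable P (\<lambda>\<omega>. lap_kernel (1 / R * S (t / real n) \<omega>))"
        using R by (intro int) auto
      show "integrable P (\<lambda>\<omega>. 6 * (2 * r / R)\<^sup>2 * lap_kernel (1 / (2 * r) * S (t / real n) \<omega>)
        + indicator ?B \<omega> + 5 * lap_kernel (1 / \<rho> * S (t / real n) \<omega>))"
        using r \<rho> by (intro Bochner_Integration.integrable_add integrable_mult_right int intB) auto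
      show "AE \<omega> in P. lap_kernel (1 / R * S (t / real n) \<omega>)
        \<le> 6 * (2 * r / R)\<^sup>2 * lap_kernel (1 / (2 * r) * S (t / real n) \<omega>)
        + indicator ?B \<omega> + 5 * lap_kernel (1 / \<rho> * S (t / real n) \<omega>)"
        using AE_nonneg[OF s] AE_space
      proof eventually_elim
        case (elim \<omega>)
        then show ?case
          using lap_kernel_scale_split[of "S (t / real n) \<omega>" "2 * r" R \<rho>] r R \<rho>
          by (simp add: indicator_def)
      qed
    qed
    also have "\<dots> = 6 * (2 * r / R)\<^sup>2 * E (1 / (2 * r)) n + prob ?B + 5 * E (1 / \<rho>) n"
      using int[of "1 / (2 * r)"] int[of "1 / \<rho>"] intB r \<rho>
      by (simp add: E_def)
    finally have "real n * (E (1 / R) n - 6 * (2 * r / R)\<^sup>2 * E (1 / (2 * r)) n - 5 * E (1 / \<rho>) n)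
        \<le> real n * prob ?B"
      by (intro mult_left_mono) auto
    from mult_left_mono[OF this less_imp_le[OF c]]
    have "c * (real n * (E (1 / R) n - 6 * (2 * r / R)\<^sup>2 * E (1 / (2 * r)) n - 5 * E (1 / \<rho>) n))
        \<le> c * (real n * prob ?B)" .
    also have "\<dots> \<le> prob {\<omega>\<in>space P. S t \<omega> \<le> 2 * r} * (real n * prob ?B)"
      unfolding c_def using prob_le_ge[OF \<phi> _ r le] t
      by (intro mult_right_mono) auto
    also have "\<dots> \<le> ?Q"
      using single_big_increment[OF t elim, of "2 * r" \<rho>] r by (simp add: mult_ac)
    finally show ?case by (simp add: algebra_simps)
  qed
  ultimately show ?thesis
    unfolding c_def by (rule tendsto_upperbound) simp
qed

end

section \<open>Choice of constants from the scaling conditions\<close>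

lemma powr_scale_small:
  fixes C p \<epsilon> :: real
  assumes "p > 0" "\<epsilon> > 0"
  obtains K where "K > 1" "C * K powr (- p) \<le> \<epsilon>"
proof -
  have "((\<lambda>x. C * x powr (- p)) \<longlongrightarrow> C * 0) at_top"
    using assms by (intro tendsto_intros tendsto_neg_powr filterlim_ident) auto
  then have "\<forall>\<^sub>F x in at_top. C * x powr (- p) < \<epsilon>"
    using assms by (intro order_tendstoD) auto
  then have "\<forall>\<^sub>F x in at_top. C * x powr (- p) < \<epsilon> \<and> x > 1"
    using eventually_gt_at_top by (rule eventually_conj)
  then obtain K where "K > 1" "C * K powr (- p) < \<epsilon>"
    using eventually_happens by (metis (no_types, lifting) trivial_limit_at_top_linorder)
  then show ?thesis by (intro that) auto
qed

text \<open>Translates the range of \<open>r\<close> into a real inequality. If l = 0, the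
  convention that 0 has inverse \<infinity> makes the restriction void, and the conclusion is
  positivity of 1 / (L r).\<close>

lemma less_inverse_ereal:
  fixes r L l :: real
  assumes "0 < r" "0 < L" "0 \<le> l" "ereal r < inverse (ereal L) * inverse (ereal l)"
  shows "l < 1 / (L * r)"
proof (cases "l = 0")
  case False
  then have "r < inverse L * inverse l" using assms by simp
  then show ?thesis using assms False by (simp add: field_simps)
qed (use assms in simp)

theorem proposition2p8:
  fixes P :: "'a measure" and S :: "real \<Rightarrow> 'a \<Rightarrow> real"
    and \<phi> :: "real \<Rightarrow> real" and \<mu> :: "real measure"
    and \<gamma> lamL CL \<delta> lamU CU :: real
  assumes "subordinator P S"
    and "laplace_exponent P S \<phi>"
    and "drift_and_levy_measure \<phi> 0 \<mu>"
    and "lower_scaling (H_of \<phi>) \<gamma> lamL CL"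
    and "upper_scaling (H_of \<phi>) \<delta> lamU CU"
    and "\<delta> < 2"
  shows "\<exists>M L cS :: real. 0 < M \<and> M < 1 \<and> L > 1 \<and> cS > 0 \<and>
    (\<forall>t r. t > 0 \<and> 0 < r \<and>
       ereal r < min (inverse (ereal L) * inverse (ereal lamL)) (ereal M * inverse (ereal lamU)) \<and>
       t * \<phi> (inverse r) \<le> 1 \<longrightarrow>
       measure P {\<omega> \<in> space P. r \<le> S t \<omega> \<and> S t \<omega> \<le> L * r} \<ge> cS * t * H_of \<phi> (inverse r))"
proof -
  interpret subordinator P S by fact
  define H where "H = H_of \<phi>"
  have H_pos: "H l > 0" if "l > 0" for l
    using assms(4) that by (auto simp: lower_scaling_def H_def)
  have g: "\<gamma> > 0" "lamL \<ge> 0" "CL > 0" and d: "lamU \<ge> 0" "CU > 0"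
    using assms(4,5) by (auto simp: lower_scaling_def upper_scaling_def)
  have lower: "CL * x powr \<gamma> * H l \<le> H (l * x)" if "l > lamL" "x \<ge> 1" for l x
    using assms(4) that H_pos[of l] g
    by (auto simp: lower_scaling_def field_simps simp flip: H_def)
  have upper: "H (l * x) \<le> CU * x powr \<delta> * H l" if "l > lamU" "x \<ge> 1" for l x
    using assms(5) that H_pos[of l] d
    by (auto simp: upper_scaling_def field_simps simp flip: H_def)
  \<comment> \<open>The exponent combines K^(-2) from (2 r / R)^2 with K^\<delta> from (U). The 6
    comes from the scale splitting, and 1/4 is the share of H(1/R) given up to small values.\<close>
  obtain K where K: "K > 1" "6 * CU * K powr (- (2 - \<delta>)) \<le> 1 / 4"
    using powr_scale_small[of "2 - \<delta>" "1 / 4" "6 * CU"] assms(6) by auto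
  \<comment> \<open>Here (L) gives the factor Q^(- \<gamma>) / CL, and 5 is the weight of the large
    values, which cost another quarter.\<close>
  obtain Q where Q: "Q > 1" "5 / CL * Q powr (- \<gamma>) \<le> 1 / 4"
    using powr_scale_small[of \<gamma> "1 / 4" "5 / CL"] g by auto
  define c where "c = exp (- 1) - exp (- 2 :: real)"
  \<comment> \<open>\<open>M\<close> makes the second bound on \<open>r\<close> say lamU < 1/R for R
    = 2 K r. \<open>L\<close> is chosen with L r = \<rho> + 2 r, so that the first bound gives lamL
    < 1/\<rho>. In \<open>cS\<close>, c/2 is what remains of \<open>c\<close> after losing two
    quarters, and CU (2 K)^\<delta> is the cost of passing from H(1/r) to H(1/R).\<close>
  define M where "M = 1 / (2 * K)"
  define L where "L = 2 * K * Q + 2"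
  define cS where "cS = c / (2 * CU * (2 * K) powr \<delta>)"
  have c: "0 < c" by (simp add: c_def)
  have KQ: "0 < K * Q" using K Q by simp
  show ?thesis
  proof (rule exI[of _ M], rule exI[of _ L], rule exI[of _ cS], intro conjI allI impI)
    show "0 < M" "M < 1" using K by (auto simp: M_def)
    show "1 < L" using KQ by (simp add: L_def)
    show "0 < cS" using c d K by (simp add: cS_def)
    fix t r :: real
    assume *: "t > 0 \<and> 0 < r \<and>
       ereal r < min (inverse (ereal L) * inverse (ereal lamL)) (ereal M * inverse (ereal lamU)) \<and>
       t * \<phi> (inverse r) \<le> 1"
    then have t: "0 < t" and r: "0 < r" and le: "t * \<phi> (inverse r) \<le> 1"
      and rm: "ereal r < inverse (ereal L) * inverse (ereal lamL)"
        "ereal r < ereal M * inverse (ereal lamU)" by auto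
    define R where "R = 2 * K * r"
    define \<rho> where "\<rho> = Q * R"
    have R: "0 < R" "R \<le> \<rho>" and \<rho>: "0 < \<rho>" "\<rho> + 2 * r = L * r" "\<rho> \<le> L * r"
      using r K Q by (auto simp: R_def \<rho>_def L_def algebra_simps)
    have "lamL < 1 / (L * r)"
      using rm(1) r g KQ by (intro less_inverse_ereal) (auto simp: L_def)
    also have "\<dots> \<le> 1 / \<rho>"
      using \<rho> by (intro divide_left_mono) auto
    finally have lamL: "lamL < 1 / \<rho>" .
    have "ereal M = inverse (ereal (2 * K))" using K by (simp add: M_def inverse_eq_divide)
    then have "ereal r < inverse (ereal (2 * K)) * inverse (ereal lamU)"
      using rm(2) by (simp only:)
    then have lamU: "lamU < 1 / R"
      unfolding R_def using r d K by (intro less_inverse_ereal) auto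
    \<comment> \<open>(U) is applied from frequency 1/R up to K/R = 1/(2 r).\<close>
    have 1: "6 * (2 * r / R)\<^sup>2 * H (1 / (2 * r)) \<le> H (1 / R) / 4"
    proof -
      have "H (1 / R * K) \<le> CU * K powr \<delta> * H (1 / R)"
        using lamU K by (intro upper) auto
      moreover have "1 / R * K = 1 / (2 * r)" "2 * r / R = 1 / K"
        using r K by (auto simp: R_def)
      ultimately have "6 * (2 * r / R)\<^sup>2 * H (1 / (2 * r)) \<le> 6 * (1 / K)\<^sup>2 * (CU * K powr \<delta> * H (1 / R))"
        by (simp add: mult_left_mono)
      also have "\<dots> = 6 * CU * K powr (- (2 - \<delta>)) * H (1 / R)"
        using K by (simp add: powr_diff power_divide)
      also have "\<dots> \<le> 1 / 4 * H (1 / R)"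
        using K(2) H_pos[of "1 / R"] R by (intro mult_right_mono) auto
      finally show ?thesis by simp
    qed
    \<comment> \<open>(L) is applied from frequency 1/\<rho> up to Q/\<rho> = 1/R, and solved for
      H(1/\<rho>).\<close>
    have 2: "5 * H (1 / \<rho>) \<le> H (1 / R) / 4"
    proof -
      have "CL * Q powr \<gamma> * H (1 / \<rho>) \<le> H (1 / \<rho> * Q)"
        using lamL Q by (intro lower) auto
      moreover have "1 / \<rho> * Q = 1 / R" using Q by (simp add: \<rho>_def)
      ultimately have "H (1 / \<rho>) \<le> H (1 / R) * Q powr (- \<gamma>) / CL"
        using g Q by (simp add: powr_minus field_simps)
      then have "5 * H (1 / \<rho>) \<le> 5 * (H (1 / R) * Q powr (- \<gamma>) / CL)"
        by linarith
      also have "\<dots> = 5 / CL * Q powr (- \<gamma>) * H (1 / R)"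
        by simp
      also have "\<dots> \<le> 1 / 4 * H (1 / R)"
        using Q(2) H_pos[of "1 / R"] R by (intro mult_right_mono) auto
      finally show ?thesis by simp
    qed
    have 3: "H (1 / r) \<le> CU * (2 * K) powr \<delta> * H (1 / R)"
    proof -
      have "1 / R * (2 * K) = 1 / r" using K by (simp add: R_def)
      then show ?thesis using upper[OF lamU, of "2 * K"] K by simp
    qed
    have "cS * t * H (inverse r) \<le> cS * t * (CU * (2 * K) powr \<delta> * H (1 / R))"
      using 3 \<open>0 < cS\<close> t by (intro mult_left_mono) (auto simp: inverse_eq_divide)
    also have "\<dots> = c * (t * (H (1 / R) / 2))"
      using d K by (simp add: cS_def)
    also have "\<dots> \<le> c * (t * (H (1 / R) - 6 * (2 * r / R)\<^sup>2 * H (1 / (2 * r)) - 5 * H (1 / \<rho>)))"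
      using 1 2 c t by (intro mult_left_mono) auto
    also have "\<dots> = c * (t * H (1 / R) - 6 * (2 * r / R)\<^sup>2 * (t * H (1 / (2 * r))) - 5 * (t * H (1 / \<rho>)))"
      by (simp only: right_diff_distrib mult_ac)
    also have "\<dots> \<le> prob {\<omega>\<in>space P. 2 * r \<le> S t \<omega> \<and> S t \<omega> \<le> \<rho> + 2 * r}"
      unfolding c_def H_def by (rule prob_interval_ge_H[OF assms(2) t r le R])
    also have "\<dots> \<le> prob {\<omega> \<in> space P. r \<le> S t \<omega> \<and> S t \<omega> \<le> L * r}"
    proof (rule finite_measure_mono)
      note [measurable] = random_variable_S[OF order.strict_implies_order[OF t]]
      show "{\<omega> \<in> space P. r \<le> S t \<omega> \<and> S t \<omega> \<le> L * r} \<in> events" by measurable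
    qed (use \<rho> r in auto)
    finally show "cS * t * H_of \<phi> (inverse r)
        \<le> measure P {\<omega> \<in> space P. r \<le> S t \<omega> \<and> S t \<omega> \<le> L * r}"
      by (simp add: H_def)
  qed
qed

end
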